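(* Consider the quantized primal-dual algorithm under an arbitrary quantization scheme $\mathcal{Q}$. Then for every time $k$ the mean square distance of the primal-dual variables from the optimal solution satisfies $$\log\mathsf{E}\left[\|\boldsymbol{\epsilon}_k\|_2^2\right]\ge\log\left(\frac{e^{1-\frac{1}{M+N}}}{2\pi e}\right)+\frac{2}{N+M}\left(\sum_{i=1}^M\sum_{n=0}^{k-1}\log\left(1+\mu_nU_i^{\min}\right)+\mathsf{h}[\boldsymbol{y}_0]-\sum_{t=0}^{k-1}\left(\sum_{i=1}^M\log|\mathcal{A}^{\boldsymbol{x}}_{i,t}|+\sum_{j=1}^N\log|\mathcal{A}^{\boldsymbol{\lambda}}_{j,t}|\right)\right),$$ where $\boldsymbol{\epsilon}_k=\boldsymbol{y}_k-\boldsymbol{y}^\star$.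
   Context: **Problem.** Let $N<M$ be positive integers, $A\in\mathbb{R}^{N\times M}$, $\boldsymbol{b}\in\mathbb{R}^N$, $U_i:\mathbb{R}\to\mathbb{R}$ ($1\le i\le M$). Consider: maximize $\sum_{i=1}^M U_i(x^i)$ over $\boldsymbol{x}=[x^1,\dots,x^M]^\top$ subject to $A\boldsymbol{x}=\boldsymbol{b}$. Let $\boldsymbol{x}^\star,\boldsymbol{\lambda}^\star$ be the optimal primal and dual solutions, and $\boldsymbol{y}^\star$ their concatenation. $A_i$ is the $i$th column of $A$, $\bar A_j$ its $j$th row. **Quantization scheme.** At time $k\ge 0$, agent $i$ encodes $x^i_k$ into a symbol $\hat Q^{\boldsymbol{x}}_{i,k}=E^{\boldsymbol{x}}_{i,k}(\{x^i_n\}_{n=0}^k,\{\hat Q^{\boldsymbol{x}}_{i,n}\}_{n=0}^{k-1})$ in a finite alphabet $\mathcal{A}^{\boldsymbol{x}}_{i,k}$, and the quantized value is reconstructed as $Q^{\boldsymbol{x}}_{i,k}=D^{\boldsymbol{x}}_{i,k}(\{\hat Q^{\boldsymbol{x}}_{i,n}\}_{n=0}^k)$. Likewise, network node $j$ ($1\le j\le N$) encodes $\lambda^j_k$ into $\hat Q^{\boldsymbol{\lambda}}_{j,k}=E^{\boldsymbol{\lambda}}_{j,k}(\{\lambda^j_n\}_{n=0}^k,\{\hat Q^{\boldsymbol{\lambda}}_{j,n}\}_{n=0}^{k-1})$ in a finite alphabet $\mathcal{A}^{\boldsymbol{\lambda}}_{j,k}$, with reconstruction $Q^{\boldsymbol{\lambda}}_{j,k}=D^{\boldsymbol{\lambda}}_{j,k}(\{\hat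 Q^{\boldsymbol{\lambda}}_{j,n}\}_{n=0}^k)$. The collection $\mathcal{Q}$ of all these encoder and decoder maps is a quantization scheme. Write $Q^{\boldsymbol{x}}_k=[Q^{\boldsymbol{x}}_{1,k},\dots,Q^{\boldsymbol{x}}_{M,k}]^\top$, $Q^{\boldsymbol{\lambda}}_k=[Q^{\boldsymbol{\lambda}}_{1,k},\dots,Q^{\boldsymbol{\lambda}}_{N,k}]^\top$. **Quantized primal-dual (PD) algorithm.** For $k\ge1$, $$x^i_k=x^i_{k-1}+\mu_{k-1}\left(U_i'(x^i_{k-1})-A_i^\top Q^{\boldsymbol{\lambda}}_{k-1}\right),\qquad \lambda^j_k=\lambda^j_{k-1}+\mu_{k-1}\left(\bar A_jQ^{\boldsymbol{x}}_{k-1}-b_j\right).$$ $\boldsymbol{y}_k$ is the concatenation of $\boldsymbol{x}_k$ and $\boldsymbol{\lambda}_k$. The initial vectors $\boldsymbol{x}_0,\boldsymbol{\lambda}_0$ are random with densities $p_{\boldsymbol{x}_0},p_{\boldsymbol{\lambda}_0}$. **Standing assumptions.** (1) Each $U_i$ is concave and twice continuously differentiable. (2) There are constants with $U_i^{\min}\le U_i''(x)\le U_i^{\max}<0$ for all $x\in\mathbb{R}$ and all $i$. (3) $0<\mu_k\le\min_i 1/|U_i^{\min}|$ for all $k$. (4) $\mu_k\to\mu^\star>0$. (5) $\boldsymbol{x}_0$ and $\boldsymbol{\lambda}_0$ are independent and have finite differential entropies. Differential entropy: $\mathsf{h}[\boldsymbol{z}]=-\int p_{\boldsymbol{z}}\log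 p_{\boldsymbol{z}}$. Logarithms are natural, with $\log0=-\infty$. *)

theory Defs
  imports "HOL-Probability.Probability"
begin

section \<open>Extended logarithm and differential entropy\<close>

text \<open>The natural logarithm on \<open>[0, \<infinity>]\<close> with \<open>log 0 = -\<infinity>\<close>.\<close>

definition ext_ln :: "ennreal \<Rightarrow> ereal" where
  "ext_ln t = (if t = 0 then - \<infinity> else if t = \<top> then \<infinity> else ereal (ln (enn2real t)))"

definition diff_entropy :: "'w measure \<Rightarrow> ('w \<Rightarrow> 'a::euclidean_space) \<Rightarrow> real" where
  "diff_entropy P Z = prob_space.entropy P (exp 1) lborel Z"

text \<open>The random vector \<open>Z\<close> has the density \<open>p\<close> and \<open>p log p\<close> is Lebesgue integrable.\<close>

definition finite_diff_entropy ::
    "'w measure \<Rightarrow> ('w \<Rightarrow> 'a::euclidean_space) \<Rightarrow> ('a \<Rightarrow> real) \<Rightarrow> bool" where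
  "finite_diff_entropy P Z p \<longleftrightarrow> information_space.finite_entropy P (exp 1) lborel Z p"

lemma diff_entropy_density:
  assumes "prob_space P" "distributed P lborel Z (\<lambda>z. ennreal (p z))" "\<And>z. 0 \<le> p z"
  shows "diff_entropy P Z = - (\<integral>z. p z * ln (p z) \<partial>lborel)"
proof -
  interpret prob_space P by fact
  interpret information_space P "exp 1" by unfold_locales simp
  show ?thesis
    unfolding diff_entropy_def using entropy_distr[OF assms(2)] assms(3)
    by (simp add: log_def)
qed


text \<open>
  Independence of two random vectors, possibly of different dimensions; the library's
  \<open>indep_var\<close> requires both to have the same type.
\<close>

definition indep_vectors ::
    "'w measure \<Rightarrow> ('w \<Rightarrow> 'a::euclidean_space) \<Rightarrow> ('w \<Rightarrow> 'b::euclidean_space) \<Rightarrow> bool" where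
  "indep_vectors P X Y \<longleftrightarrow>
     X \<in> borel_measurable P \<and> Y \<in> borel_measurable P \<and>
     prob_space.indep_set P {X -` S \<inter> space P | S. S \<in> sets borel}
                            {Y -` S \<inter> space P | S. S \<in> sets borel}"


section \<open>The optimization problem and its dual\<close>

text \<open>
  The problem is to maximize \<open>\<Sum>i. U i (x $ i)\<close> subject to \<open>A *v x = b\<close>.  The sign of the
  multiplier is the one for which the primal-dual iteration below ascends the Lagrangian in the
  primal and descends it in the dual variables.
\<close>

definition utility :: "('m::finite \<Rightarrow> real \<Rightarrow> real) \<Rightarrow> real^'m \<Rightarrow> real" where
  "utility U x = (\<Sum>i\<in>UNIV. U i (x $ i))"

definition primal_optimal ::
    "real^'m^'n \<Rightarrow> real^'n \<Rightarrow> ('m::finite \<Rightarrow> real \<Rightarrow> real) \<Rightarrow> real^'m \<Rightarrow> bool" where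
  "primal_optimal A b U = is_arg_max (utility U) (\<lambda>x. A *v x = b)"

definition lagrangian ::
    "real^'m^'n \<Rightarrow> real^'n \<Rightarrow> ('m::finite \<Rightarrow> real \<Rightarrow> real) \<Rightarrow> real^'m \<Rightarrow> real^'n \<Rightarrow> real" where
  "lagrangian A b U x lam = utility U x - lam \<bullet> (A *v x - b)"

definition dual_function ::
    "real^'m^'n \<Rightarrow> real^'n \<Rightarrow> ('m::finite \<Rightarrow> real \<Rightarrow> real) \<Rightarrow> real^'n \<Rightarrow> ereal" where
  "dual_function A b U lam = (SUP x. ereal (lagrangian A b U x lam))"

definition dual_optimal ::
    "real^'m^'n \<Rightarrow> real^'n \<Rightarrow> ('m::finite \<Rightarrow> real \<Rightarrow> real) \<Rightarrow> real^'n \<Rightarrow> bool" where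
  "dual_optimal A b U = is_arg_min (dual_function A b U) (\<lambda>lam. True)"


section \<open>Quantization schemes\<close>

text \<open>
  A quantizer for a family of scalar signals indexed by \<open>'i\<close>.  A history \<open>z\<^sub>0, \<dots>, z\<^sub>k\<close> is a
  function on \<open>{..k}\<close>, undefined elsewhere, so that a map at time \<open>k\<close> cannot look
  ahead.
\<close>

record ('i, 's) quantizer =
  alphabet :: "'i \<Rightarrow> nat \<Rightarrow> 's set"
  encoder :: "'i \<Rightarrow> nat \<Rightarrow> (nat \<Rightarrow> real) \<Rightarrow> (nat \<Rightarrow> 's) \<Rightarrow> 's"
  decoder :: "'i \<Rightarrow> nat \<Rightarrow> (nat \<Rightarrow> 's) \<Rightarrow> real"

text \<open>
  Membership in the measurable function space says both that the encoder takes its values in the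
  alphabet and that it is measurable, without which the iterates would not be random variables.
  Decoders have a finite discrete domain and need no condition.
\<close>

definition valid_quantizer :: "('i, 's) quantizer \<Rightarrow> bool" where
  "valid_quantizer Q \<longleftrightarrow> (\<forall>i k. finite (alphabet Q i k) \<and>
     (\<lambda>(z, s). encoder Q i k z s) \<in>
       (\<Pi>\<^sub>M n\<in>{..k}. (borel :: real measure)) \<Otimes>\<^sub>M (\<Pi>\<^sub>M n\<in>{..<k}. count_space (alphabet Q i n))
       \<rightarrow>\<^sub>M count_space (alphabet Q i k))"

text \<open>\<open>s\<close> are the transmitted symbols and \<open>q\<close> the reconstructed values for the signal \<open>z\<close>.\<close>

definition quantizes ::
    "('i::finite, 's) quantizer \<Rightarrow> (nat \<Rightarrow> real^'i) \<Rightarrow> (nat \<Rightarrow> 'i \<Rightarrow> 's) \<Rightarrow> (nat \<Rightarrow> real^'i) \<Rightarrow> bool" where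
  "quantizes Q z s q \<longleftrightarrow> (\<forall>k i.
     s k i = encoder Q i k (restrict (\<lambda>n. z n $ i) {..k}) (restrict (\<lambda>n. s n i) {..<k}) \<and>
     q k $ i = decoder Q i k (restrict (\<lambda>n. s n i) {..k}))"


section \<open>The quantized primal-dual algorithm\<close>

text \<open>\<open>x\<close> and \<open>lam\<close> form a (deterministic) trajectory of the algorithm.\<close>

definition quantized_pd ::
    "real^'m^'n \<Rightarrow> real^'n \<Rightarrow> ('m::finite \<Rightarrow> real \<Rightarrow> real) \<Rightarrow> (nat \<Rightarrow> real)
     \<Rightarrow> ('m, 's) quantizer \<Rightarrow> ('n::finite, 't) quantizer
     \<Rightarrow> (nat \<Rightarrow> real^'m) \<Rightarrow> (nat \<Rightarrow> real^'n) \<Rightarrow> bool" where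
  "quantized_pd A b U \<mu> Qx Ql x lam \<longleftrightarrow>
     (\<exists>sx qx sl ql. quantizes Qx x sx qx \<and> quantizes Ql lam sl ql \<and>
       (\<forall>k. (\<forall>i. x (Suc k) $ i = x k $ i + \<mu> k * (deriv (U i) (x k $ i) - column i A \<bullet> ql k)) \<and>
            (\<forall>j. lam (Suc k) $ j = lam k $ j + \<mu> k * (row j A \<bullet> qx k - b $ j))))"

definition twice_cont_differentiable :: "(real \<Rightarrow> real) \<Rightarrow> bool" where
  "twice_cont_differentiable f \<longleftrightarrow>
     f differentiable_on UNIV \<and> deriv f differentiable_on UNIV \<and>
     continuous_on UNIV (deriv (deriv f))"

end

theory Submission
  imports Defs
begin

text \<open>
  The quantized algorithm reaches the iterates only through the transmitted symbols. Once the
  transcript \<open>\<sigma>\<close> of all symbols sent before time \<open>k\<close> is fixed, the iterate at time \<open>k\<close> is a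
  deterministic function \<open>G \<sigma>\<close> of the initial vector \<open>Z\<close>, and this function acts on every coordinate
  separately: primal coordinates undergo gradient steps \<open>t + \<mu> (U' t - w)\<close>, whose derivative
  is at least \<open>1 + \<mu> Umin\<close>, and dual coordinates are translated. So \<open>G \<sigma>\<close> contracts volume at most
  by the factor \<open>J = \<Prod>i. \<Prod>n. 1 + \<mu>\<^sub>n Umin\<^sub>i\<close>, and there are at most
  \<open>K = \<Prod>t. (\<Prod>i. card (alphabet Qx i t)) * (\<Prod>j. card (alphabet Ql j t))\<close> transcripts.

  Let \<open>N\<close> be the density of the isotropic normal distribution on \<open>\<real>\<^sup>d\<close>, \<open>d\<close> the sum of the primal and
  dual dimensions, centred at the optimum and with variance \<open>v\<close> in each coordinate. The mixture
  \<open>q z = (\<Sum>\<sigma>. J * N (G \<sigma> z))\<close> has total mass at most \<open>K\<close>, so Gibbs' inequality against the density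
  of \<open>Z\<close> gives \<open>E[- ln q(Z)] \<ge> h[Z] - ln K\<close>. On the other hand \<open>q(Z)\<close> dominates the summand of
  the transcript that actually occurred, which is \<open>J N(Y)\<close> for the iterate \<open>Y\<close>; hence
  \<open>- ln q(Z) \<le> - ln J + d/2 ln (2 pi v) + \<parallel>Y - c\<parallel>\<^sup>2 / (2 v)\<close> pointwise. Taking expectations and choosing
  \<open>v\<close> optimally yields \<open>E \<parallel>Y - c\<parallel>\<^sup>2 \<ge> d / (2 pi e) * exp (2/d (h[Z] + ln J - ln K))\<close>
  (\<open>mean_square_ge_of_expanding_branches\<close>). The mixture runs over all transcripts at every
  point, so the cells on which each transcript occurs never enter, and no conditional
  entropies have to be formed. The constant of the theorem follows from
  \<open>exp (1 - 1/d) \<le> d\<close>; if some factor \<open>1 + \<mu>\<^sub>n Umin\<^sub>i\<close> vanishes, the right-hand side is \<open>- \<infinity>\<close>.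
\<close>

section \<open>Maps of the line that contract length boundedly\<close>

text \<open>
  In terms of sets: \<open>a\<close> times the measure of the preimage of a Borel set \<open>B\<close> is at most that of \<open>B\<close>.
  The formulation by test functions is closed under composition and fits products of
  one-dimensional densities.
\<close>

definition expanding :: "real \<Rightarrow> (real \<Rightarrow> real) \<Rightarrow> bool" where
  "expanding a \<phi> \<longleftrightarrow> \<phi> \<in> borel_measurable borel \<and>
     (\<forall>g :: real \<Rightarrow> ennreal. g \<in> borel_measurable borel \<longrightarrow>
        (\<integral>\<^sup>+t. ennreal a * g (\<phi> t) \<partial>lborel) \<le> (\<integral>\<^sup>+u. g u \<partial>lborel))"

lemma expanding_measurable: "expanding a \<phi> \<Longrightarrow> \<phi> \<in> borel_measurable borel"
  unfolding expanding_def by blast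

lemma expandingD:
  fixes g :: "real \<Rightarrow> ennreal"
  assumes "expanding a \<phi>" "g \<in> borel_measurable borel"
  shows "(\<integral>\<^sup>+t. ennreal a * g (\<phi> t) \<partial>lborel) \<le> (\<integral>\<^sup>+u. g u \<partial>lborel)"
  using assms unfolding expanding_def by blast

lemma expanding_id: "expanding 1 (\<lambda>t. t)"
  unfolding expanding_def by simp

lemma expanding_compose:
  assumes \<phi>: "expanding a \<phi>" and \<psi>: "expanding c \<psi>" and "0 \<le> a" "0 \<le> c"
  shows "expanding (a * c) (\<lambda>t. \<psi> (\<phi> t))"
  unfolding expanding_def
proof (intro conjI allI impI)
  note [measurable] = expanding_measurable[OF \<phi>] expanding_measurable[OF \<psi>]
  show "(\<lambda>t. \<psi> (\<phi> t)) \<in> borel_measurable borel"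
    by measurable
  fix g :: "real \<Rightarrow> ennreal" assume [measurable]: "g \<in> borel_measurable borel"
  have "(\<integral>\<^sup>+t. ennreal (a * c) * g (\<psi> (\<phi> t)) \<partial>lborel)
      = (\<integral>\<^sup>+t. ennreal a * (ennreal c * g (\<psi> (\<phi> t))) \<partial>lborel)"
    using assms by (simp add: ennreal_mult mult.assoc)
  also have "\<dots> \<le> (\<integral>\<^sup>+u. ennreal c * g (\<psi> u) \<partial>lborel)"
    by (rule expandingD[OF \<phi>, of "\<lambda>u. ennreal c * g (\<psi> u)"]) measurable
  also have "\<dots> \<le> (\<integral>\<^sup>+u. g u \<partial>lborel)"
    by (rule expandingD[OF \<psi>]) measurable
  finally show "(\<integral>\<^sup>+t. ennreal (a * c) * g (\<psi> (\<phi> t)) \<partial>lborel) \<le> (\<integral>\<^sup>+u. g u \<partial>lborel)" .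
qed

text \<open>
  Substitution on \<open>[-n, n]\<close> turns \<open>\<integral> g(\<phi> t) \<phi>'(t) dt\<close> into the integral of \<open>g\<close> over the image interval;
  \<open>\<phi>\<close> need not be onto, whence only an inequality after \<open>n \<rightarrow> \<infinity>\<close>.
\<close>

lemma expanding_if_deriv_ge:
  assumes deriv: "\<And>t. (\<phi> has_real_derivative \<phi>' t) (at t)"
    and cont: "continuous_on UNIV \<phi>'" and ge: "\<And>t. a \<le> \<phi>' t" and "0 \<le> a"
  shows "expanding a \<phi>"
  unfolding expanding_def
proof (intro conjI allI impI)
  have "continuous_on UNIV \<phi>"
    by (meson deriv DERIV_isCont continuous_at_imp_continuous_on)
  then show meas[measurable]: "\<phi> \<in> borel_measurable borel"
    by (rule borel_measurable_continuous_onI)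
  fix g :: "real \<Rightarrow> ennreal" assume [measurable]: "g \<in> borel_measurable borel"
  define I where "I n = {- real (Suc n)..real (Suc n)}" for n
  have on_interval: "(\<integral>\<^sup>+t. ennreal a * g (\<phi> t) * indicator (I n) t \<partial>lborel) \<le> (\<integral>\<^sup>+u. g u \<partial>lborel)"
    for n
  proof -
    have "(\<integral>\<^sup>+t. ennreal a * g (\<phi> t) * indicator (I n) t \<partial>lborel)
        \<le> (\<integral>\<^sup>+t. g (\<phi> t) * ennreal (\<phi>' t) * indicator (I n) t \<partial>lborel)"
      by (intro nn_integral_mono mult_right_mono, subst mult.commute)
         (auto intro!: mult_left_mono ennreal_leI ge)
    also have "\<dots> = (\<integral>\<^sup>+u. g u * indicator {\<phi> (- real (Suc n))..\<phi> (real (Suc n))} u \<partial>lborel)"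
      unfolding I_def
      by (rule nn_integral_substitution_aux[symmetric])
         (use deriv order_trans[OF \<open>0 \<le> a\<close> ge] continuous_on_subset[OF cont] in auto)
    also have "\<dots> \<le> (\<integral>\<^sup>+u. g u \<partial>lborel)"
      by (intro nn_integral_mono) (auto split: split_indicator)
    finally show ?thesis .
  qed
  have exhaust: "(SUP n. ennreal a * g (\<phi> t) * indicator (I n) t) = ennreal a * g (\<phi> t)" for t
  proof (rule antisym)
    show "(SUP n. ennreal a * g (\<phi> t) * indicator (I n) t) \<le> ennreal a * g (\<phi> t)"
      by (intro SUP_least) (auto split: split_indicator)
    obtain n :: nat where "\<bar>t\<bar> \<le> real n"
      using real_arch_simple by blast
    then have "t \<in> I n"
      by (auto simp: I_def)
    then show "ennreal a * g (\<phi> t) \<le> (SUP n. ennreal a * g (\<phi> t) * indicator (I n) t)"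
      by (intro SUP_upper2[of n]) auto
  qed
  have "(\<integral>\<^sup>+t. ennreal a * g (\<phi> t) \<partial>lborel)
      = (\<integral>\<^sup>+t. (SUP n. ennreal a * g (\<phi> t) * indicator (I n) t) \<partial>lborel)"
    by (simp only: exhaust)
  also have "\<dots> = (SUP n. \<integral>\<^sup>+t. ennreal a * g (\<phi> t) * indicator (I n) t \<partial>lborel)"
  proof (rule nn_integral_monotone_convergence_SUP)
    show "incseq (\<lambda>n t. ennreal a * g (\<phi> t) * indicator (I n) t)"
      by (auto simp: incseq_def le_fun_def I_def split: split_indicator)
    show "(\<lambda>t. ennreal a * g (\<phi> t) * indicator (I n) t) \<in> borel_measurable lborel" for n
      unfolding I_def by measurable
  qed
  also have "\<dots> \<le> (\<integral>\<^sup>+u. g u \<partial>lborel)"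
    by (intro SUP_least on_interval)
  finally show "(\<integral>\<^sup>+t. ennreal a * g (\<phi> t) \<partial>lborel) \<le> (\<integral>\<^sup>+u. g u \<partial>lborel)" .
qed

section \<open>Normal densities pulled back along coordinatewise maps\<close>

definition isotropic_normal :: "'a::euclidean_space \<Rightarrow> real \<Rightarrow> 'a \<Rightarrow> real" where
  "isotropic_normal c \<sigma> y = (\<Prod>b\<in>Basis. normal_density (c \<bullet> b) \<sigma> (y \<bullet> b))"

lemma ln_isotropic_normal:
  fixes c y :: "'a::euclidean_space"
  assumes "0 < \<sigma>"
  shows "ln (isotropic_normal c \<sigma> y)
    = - (DIM('a) / 2 * ln (2 * pi * \<sigma>\<^sup>2) + (norm (y - c))\<^sup>2 / (2 * \<sigma>\<^sup>2))"
proof -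
  have "ln (normal_density m \<sigma> t) = - (ln (2 * pi * \<sigma>\<^sup>2) / 2) - (t - m)\<^sup>2 / (2 * \<sigma>\<^sup>2)" for m t
    using assms by (simp add: normal_density_def ln_mult ln_div ln_sqrt)
  then have "ln (isotropic_normal c \<sigma> y)
      = (\<Sum>b\<in>Basis. - (ln (2 * pi * \<sigma>\<^sup>2) / 2) - ((y - c) \<bullet> b)\<^sup>2 / (2 * \<sigma>\<^sup>2))"
    unfolding isotropic_normal_def using normal_density_pos[OF assms]
    by (subst ln_prod) (auto simp: inner_diff_left less_imp_neq[symmetric])
  also have "\<dots> = - (DIM('a) / 2 * ln (2 * pi * \<sigma>\<^sup>2) + (\<Sum>b\<in>Basis. ((y - c) \<bullet> b)\<^sup>2) / (2 * \<sigma>\<^sup>2))"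
    by (simp add: sum_subtractf sum_divide_distrib)
  also have "(\<Sum>b\<in>Basis. ((y - c) \<bullet> b)\<^sup>2) = (norm (y - c))\<^sup>2"
    unfolding power2_norm_eq_inner by (subst (2) euclidean_inner) (simp add: power2_eq_square)
  finally show ?thesis .
qed

lemma nn_integral_normal_density:
  "0 < \<sigma> \<Longrightarrow> (\<integral>\<^sup>+t. ennreal (normal_density m \<sigma> t) \<partial>lborel) = 1"
  by (subst nn_integral_eq_integral) auto

text \<open>
  The density factors over the coordinates, and so does the map, so the integral is a product of
  one-dimensional ones and no multidimensional change of variables is required.
\<close>

lemma nn_integral_expanded_normal_le_1:
  fixes c :: "'a::euclidean_space"
  assumes exp: "\<And>b. b \<in> Basis \<Longrightarrow> expanding (a b) (\<phi> b)" and a: "\<And>b. b \<in> Basis \<Longrightarrow> 0 < a b"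
    and "0 < \<sigma>"
  shows "(\<integral>\<^sup>+z. ennreal ((\<Prod>b\<in>Basis. a b) * (\<Prod>b\<in>Basis. normal_density (c \<bullet> b) \<sigma> (\<phi> b (z \<bullet> b)))) \<partial>lborel) \<le> 1"
proof -
  have "(\<integral>\<^sup>+z. ennreal ((\<Prod>b\<in>Basis. a b) * (\<Prod>b\<in>Basis. normal_density (c \<bullet> b) \<sigma> (\<phi> b (z \<bullet> b)))) \<partial>lborel)
      = (\<integral>\<^sup>+z. (\<Prod>b\<in>Basis. ennreal (a b) * ennreal (normal_density (c \<bullet> b) \<sigma> (\<phi> b (z \<bullet> b)))) \<partial>(lborel :: 'a measure))"
    using a by (simp add: prod.distrib[symmetric] prod_ennreal ennreal_mult[symmetric] less_imp_le)
  also have "\<dots> = (\<Prod>b\<in>Basis. \<integral>\<^sup>+t. ennreal (a b) * ennreal (normal_density (c \<bullet> b) \<sigma> (\<phi> b t)) \<partial>lborel)"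
  proof (rule nn_integral_lborel_prod)
    fix b :: 'a assume "b \<in> Basis"
    note [measurable] = expanding_measurable[OF exp[OF this]]
    show "(\<lambda>t. ennreal (a b) * ennreal (normal_density (c \<bullet> b) \<sigma> (\<phi> b t))) \<in> borel_measurable borel"
      by measurable
  qed simp
  also have "\<dots> \<le> (\<Prod>b\<in>(Basis :: 'a set). 1)"
  proof (rule prod_mono_ennreal)
    fix b :: 'a assume b: "b \<in> Basis"
    have "(\<integral>\<^sup>+t. ennreal (a b) * ennreal (normal_density (c \<bullet> b) \<sigma> (\<phi> b t)) \<partial>lborel)
        \<le> (\<integral>\<^sup>+u. ennreal (normal_density (c \<bullet> b) \<sigma> u) \<partial>lborel)"
      by (rule expandingD[OF exp[OF b], of "\<lambda>u. ennreal (normal_density (c \<bullet> b) \<sigma> u)"]) measurable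
    then show "(\<integral>\<^sup>+t. ennreal (a b) * ennreal (normal_density (c \<bullet> b) \<sigma> (\<phi> b t)) \<partial>lborel) \<le> 1"
      using nn_integral_normal_density[OF \<open>0 < \<sigma>\<close>] by simp
  qed
  finally show ?thesis by simp
qed

section \<open>Gibbs' inequality\<close>

text \<open>This is \<open>ln s \<le> s - 1\<close> at \<open>s = q / (K p)\<close>, multiplied by \<open>p > 0\<close>.\<close>

lemma Gibbs_pointwise:
  fixes p q K :: real
  assumes "0 \<le> p" "0 < q" "0 < K"
  shows "p * ln q \<le> p * ln p + p * ln K + q / K - p"
proof (cases "p = 0")
  case False
  with assms have p: "0 < p" by simp
  have "ln (q / (K * p)) \<le> q / (K * p) - 1"
    using assms p by (intro ln_le_minus_one) simp
  then have "p * ln (q / (K * p)) \<le> p * (q / (K * p) - 1)"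
    using p by (intro mult_left_mono) auto
  also have "\<dots> = q / K - p"
    using p by (simp add: field_simps)
  also have "p * ln (q / (K * p)) = p * ln q - p * ln K - p * ln p"
    using assms p by (simp add: ln_div ln_mult algebra_simps)
  finally show ?thesis by simp
qed (use assms in simp)

lemma integral_le_nn_integral:
  fixes r :: "'b \<Rightarrow> real"
  assumes "integrable M r"
  shows "ennreal (\<integral>z. r z \<partial>M) \<le> (\<integral>\<^sup>+z. ennreal (r z) \<partial>M)"
proof -
  have fin: "(\<integral>\<^sup>+z. ennreal (r z) \<partial>M) < \<top>"
    using assms by (auto simp: real_integrable_def less_top)
  have "(\<integral>z. r z \<partial>M) \<le> enn2real (\<integral>\<^sup>+z. ennreal (r z) \<partial>M)"
    using real_lebesgue_integral_def[OF assms] by simp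
  then have "ennreal (\<integral>z. r z \<partial>M) \<le> ennreal (enn2real (\<integral>\<^sup>+z. ennreal (r z) \<partial>M))"
    by (rule ennreal_leI)
  with fin show ?thesis by simp
qed

text \<open>
  Gibbs' inequality \<open>E[- ln q(Z)] \<ge> h[Z] - ln K\<close> for a function \<open>q\<close> of total mass at most \<open>K\<close>, after
  the affine map \<open>t \<mapsto> L + \<beta> t\<close>. The expectation itself need not exist as a Bochner integral;
  the nonnegative integral of the truncation at \<open>0\<close> always does, and it is what a mean square
  error is later compared with.
\<close>

lemma Gibbs_nn_integral:
  fixes Z :: "'w \<Rightarrow> 'a::euclidean_space" and p q :: "'a \<Rightarrow> real"
  assumes "prob_space P" and Z: "distributed P lborel Z (\<lambda>z. ennreal (p z))"
    and p: "\<And>z. 0 \<le> p z" and plnp: "integrable lborel (\<lambda>z. p z * ln (p z))"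
    and q: "\<And>z. 0 < q z" and [measurable]: "q \<in> borel_measurable borel"
    and q_le: "(\<integral>\<^sup>+z. ennreal (q z) \<partial>lborel) \<le> ennreal K" and K: "0 < K" and \<beta>: "0 \<le> \<beta>"
  shows "ennreal (L + \<beta> * (- (\<integral>z. p z * ln (p z) \<partial>lborel) - ln K))
    \<le> (\<integral>\<^sup>+\<omega>. ennreal (L - \<beta> * ln (q (Z \<omega>))) \<partial>P)"
proof -
  interpret prob_space P by fact
  have [measurable]: "p \<in> borel_measurable borel"
    using distributed_real_measurable[OF _ Z] p by simp
  have "(\<integral>\<^sup>+z. ennreal (p z) \<partial>lborel) = 1"
    using distributed_nn_integral[OF Z, of "\<lambda>_. 1"] by (simp add: emeasure_space_1)
  then have p_int: "integrable lborel p" and p_1: "(\<integral>z. p z \<partial>lborel) = 1"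
    using p by (auto intro!: integrableI_nonneg simp: integral_eq_nn_integral)
  have q_int: "integrable lborel q"
    using q q_le by (intro integrableI_nonneg) (auto simp: less_imp_le order.strict_trans1)
  have q_int_le: "(\<integral>z. q z \<partial>lborel) \<le> K"
    using q_le q K nn_integral_eq_integral[OF q_int] by (simp add: less_imp_le)
  \<comment> \<open>An integrable minorant of \<open>p z * (L - \<beta> * ln (q z))\<close>, which itself might fail to be integrable.\<close>
  define r where "r z = L * p z - \<beta> * (p z * ln (p z) + p z * ln K + q z / K - p z)" for z
  have r_int: "integrable lborel r"
    unfolding r_def using p_int q_int plnp by auto
  have "(\<integral>z. r z \<partial>lborel)
      = L - \<beta> * ((\<integral>z. p z * ln (p z) \<partial>lborel) + ln K + (\<integral>z. q z \<partial>lborel) / K - 1)"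
    unfolding r_def using p_int q_int plnp by (simp add: p_1)
  also have "\<dots> \<ge> L - \<beta> * ((\<integral>z. p z * ln (p z) \<partial>lborel) + ln K)"
    using q_int_le K \<beta> by (intro diff_left_mono mult_left_mono) (simp_all add: field_simps)
  finally have "ennreal (L + \<beta> * (- (\<integral>z. p z * ln (p z) \<partial>lborel) - ln K)) \<le> ennreal (\<integral>z. r z \<partial>lborel)"
    by (intro ennreal_leI) (simp add: algebra_simps)
  also have "\<dots> \<le> (\<integral>\<^sup>+z. ennreal (r z) \<partial>lborel)"
    by (rule integral_le_nn_integral[OF r_int])
  also have "\<dots> \<le> (\<integral>\<^sup>+z. ennreal (p z) * ennreal (L - \<beta> * ln (q z)) \<partial>lborel)"
  proof (rule nn_integral_mono)
    fix z :: 'a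
    have "r z \<le> p z * (L - \<beta> * ln (q z))"
      using mult_left_mono[OF Gibbs_pointwise[OF p q K] \<beta>, of z z] by (simp add: r_def algebra_simps)
    then show "ennreal (r z) \<le> ennreal (p z) * ennreal (L - \<beta> * ln (q z))"
      using p by (simp add: ennreal_mult'[symmetric] ennreal_leI)
  qed
  also have "\<dots> = (\<integral>\<^sup>+\<omega>. ennreal (L - \<beta> * ln (q (Z \<omega>))) \<partial>P)"
    by (rule distributed_nn_integral[OF Z]) measurable
  finally show ?thesis .
qed

section \<open>The mean square of a vector reached through finitely many branches\<close>

text \<open>
  An entropy power inequality: \<open>Y\<close> arises from \<open>Z\<close> by one of \<open>card S\<close> coordinatewise maps, each of
  which lowers entropy by at most \<open>- (\<Sum>b. ln (a b))\<close>, and the choice among them accounts for at most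
  \<open>ln (card S)\<close> further units. The choice may depend on the outcome in any way, because the
  proof bounds \<open>Y\<close> pointwise by a sum over all branches.
\<close>

lemma mean_square_ge_of_expanding_branches:
  fixes Z Y :: "'w \<Rightarrow> 'a::euclidean_space" and p :: "'a \<Rightarrow> real"
  assumes "prob_space P" and Z: "distributed P lborel Z (\<lambda>z. ennreal (p z))"
    and p: "\<And>z. 0 \<le> p z" and plnp: "integrable lborel (\<lambda>z. p z * ln (p z))"
    and S: "finite S"
    and exp: "\<And>\<sigma> b. \<sigma> \<in> S \<Longrightarrow> b \<in> Basis \<Longrightarrow> expanding (a b) (\<phi> \<sigma> b)"
    and a: "\<And>b. b \<in> Basis \<Longrightarrow> 0 < a b"
    and Y: "\<And>\<omega>. \<omega> \<in> space P \<Longrightarrow> \<exists>\<sigma>\<in>S. \<forall>b\<in>Basis. Y \<omega> \<bullet> b = \<phi> \<sigma> b (Z \<omega> \<bullet> b)"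
  shows "ennreal (DIM('a) / (2 * pi * exp 1)
      * exp (2 / DIM('a) * (- (\<integral>z. p z * ln (p z) \<partial>lborel) + (\<Sum>b\<in>Basis. ln (a b)) - ln (card S))))
    \<le> (\<integral>\<^sup>+\<omega>. ennreal ((norm (Y \<omega> - c))\<^sup>2) \<partial>P)"
proof -
  interpret prob_space P by fact
  have "S \<noteq> {}"
    using Y not_empty by blast
  then have K: "0 < real (card S)"
    using S by (simp add: card_gt_0_iff)
  define d where "d = real DIM('a)"
  have d: "0 < d"
    by (simp add: d_def)
  define h where "h = - (\<integral>z. p z * ln (p z) \<partial>lborel)"
  define lnJ where "lnJ = (\<Sum>b\<in>Basis. ln (a b))"
  define C where "C = h + lnJ - ln (card S)"
  \<comment> \<open>This variance maximizes the lower bound \<open>2 * v * (C - d / 2 * ln (2 * pi * v))\<close> found below.\<close>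
  define v where "v = exp (2 * C / d - 1) / (2 * pi)"
  have v: "0 < v"
    by (simp add: v_def)
  have ln_v: "ln (2 * pi * v) = 2 * C / d - 1"
    by (simp add: v_def)
  define G where "G \<sigma> z = (\<Sum>b\<in>Basis. \<phi> \<sigma> b (z \<bullet> b) *\<^sub>R b)" for \<sigma> z
  have G_inner: "G \<sigma> z \<bullet> b = \<phi> \<sigma> b (z \<bullet> b)" if "b \<in> Basis" for \<sigma> z b
    using that by (simp add: G_def)
  define J where "J = (\<Prod>b\<in>Basis. a b)"
  have J: "0 < J"
    unfolding J_def by (rule prod_pos) (rule a)
  have ln_J: "ln J = lnJ"
    unfolding J_def lnJ_def by (rule ln_prod) (use a in \<open>auto simp: less_imp_neq[symmetric]\<close>)
  define N where "N = isotropic_normal c (sqrt v)"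
  have N_pos: "0 < N y" for y
    unfolding N_def isotropic_normal_def using v by (intro prod_pos normal_density_pos) auto
  define q where "q z = (\<Sum>\<sigma>\<in>S. J * N (G \<sigma> z))" for z
  have q_pos: "0 < q z" for z
    unfolding q_def using S \<open>S \<noteq> {}\<close> J N_pos by (intro sum_pos) auto
  have NG: "N (G \<sigma> z) = (\<Prod>b\<in>Basis. normal_density (c \<bullet> b) (sqrt v) (\<phi> \<sigma> b (z \<bullet> b)))" for \<sigma> z
    unfolding N_def isotropic_normal_def by (intro prod.cong) (simp_all add: G_inner)
  have NG_meas[measurable]: "(\<lambda>z. N (G \<sigma> z)) \<in> borel_measurable borel" if "\<sigma> \<in> S" for \<sigma>
    unfolding NG
  proof (rule borel_measurable_prod)
    fix b :: 'a assume "b \<in> Basis"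
    note [measurable] = expanding_measurable[OF exp[OF \<open>\<sigma> \<in> S\<close> this]]
    show "(\<lambda>z. normal_density (c \<bullet> b) (sqrt v) (\<phi> \<sigma> b (z \<bullet> b))) \<in> borel_measurable borel"
      by measurable
  qed
  have q_meas: "q \<in> borel_measurable borel"
    unfolding q_def[abs_def] by (intro borel_measurable_sum) measurable
  have "ennreal (q z) = (\<Sum>\<sigma>\<in>S. ennreal (J * N (G \<sigma> z)))" for z
    unfolding q_def using J N_pos by (intro sum_ennreal[symmetric]) (simp add: less_imp_le)
  then have "(\<integral>\<^sup>+z. ennreal (q z) \<partial>lborel) = (\<Sum>\<sigma>\<in>S. \<integral>\<^sup>+z. ennreal (J * N (G \<sigma> z)) \<partial>lborel)"
    by (simp only:) (intro nn_integral_sum; measurable)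
  also have "\<dots> \<le> (\<Sum>\<sigma>\<in>S. 1)"
    unfolding NG J_def using v a by (intro sum_mono nn_integral_expanded_normal_le_1 exp) auto
  finally have q_le: "(\<integral>\<^sup>+z. ennreal (q z) \<partial>lborel) \<le> ennreal (card S)"
    by (simp add: ennreal_of_nat_eq_real_of_nat)
  define L where "L = 2 * v * (lnJ - d / 2 * ln (2 * pi * v))"
  have pointwise: "L - 2 * v * ln (q (Z \<omega>)) \<le> (norm (Y \<omega> - c))\<^sup>2" if \<omega>: "\<omega> \<in> space P" for \<omega>
  proof -
    obtain \<sigma> where \<sigma>: "\<sigma> \<in> S" "\<And>b. b \<in> Basis \<Longrightarrow> Y \<omega> \<bullet> b = \<phi> \<sigma> b (Z \<omega> \<bullet> b)"
      using Y[OF \<omega>] by blast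
    have Y_eq: "Y \<omega> = G \<sigma> (Z \<omega>)"
      by (rule euclidean_eqI) (simp add: G_inner \<sigma>)
    have "J * N (Y \<omega>) \<le> q (Z \<omega>)"
      unfolding q_def Y_eq using S \<sigma> J N_pos
      by (intro member_le_sum[of \<sigma> S "\<lambda>\<sigma>. J * N (G \<sigma> (Z \<omega>))"]) (auto simp: less_imp_le)
    then have "ln (J * N (Y \<omega>)) \<le> ln (q (Z \<omega>))"
      using J N_pos[of "Y \<omega>"] by (intro ln_mono) auto
    moreover have "ln (J * N (Y \<omega>)) = lnJ - d / 2 * ln (2 * pi * v) - (norm (Y \<omega> - c))\<^sup>2 / (2 * v)"
      using J N_pos[of "Y \<omega>"] v ln_isotropic_normal[of "sqrt v" c "Y \<omega>"]
      by (simp add: ln_mult ln_J N_def d_def)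
    ultimately have "lnJ - d / 2 * ln (2 * pi * v) - ln (q (Z \<omega>)) \<le> (norm (Y \<omega> - c))\<^sup>2 / (2 * v)"
      by simp
    then have "2 * v * (lnJ - d / 2 * ln (2 * pi * v) - ln (q (Z \<omega>))) \<le> (norm (Y \<omega> - c))\<^sup>2"
      using v by (simp add: pos_le_divide_eq mult.commute)
    then show ?thesis
      by (simp add: L_def right_diff_distrib)
  qed
  have "L + 2 * v * (h - ln (card S)) = 2 * v * (C - d / 2 * ln (2 * pi * v))"
    by (simp add: L_def C_def algebra_simps)
  also have "\<dots> = d * v"
    unfolding ln_v using d by (simp add: field_simps)
  also have "\<dots> = d / (2 * pi * exp 1) * exp (2 / d * C)"
    by (simp add: v_def exp_diff)
  finally have "ennreal (d / (2 * pi * exp 1) * exp (2 / d * C)) = ennreal (L + 2 * v * (h - ln (card S)))"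
    by simp
  also have "\<dots> \<le> (\<integral>\<^sup>+\<omega>. ennreal (L - 2 * v * ln (q (Z \<omega>))) \<partial>P)"
    unfolding h_def
    by (rule Gibbs_nn_integral[OF \<open>prob_space P\<close> Z p plnp q_pos q_meas q_le K]) (use v in simp)
  also have "\<dots> \<le> (\<integral>\<^sup>+\<omega>. ennreal ((norm (Y \<omega> - c))\<^sup>2) \<partial>P)"
    by (intro nn_integral_mono ennreal_leI pointwise)
  finally show ?thesis
    by (simp add: d_def h_def C_def lnJ_def)
qed


section \<open>The joint density of independent vectors\<close>

lemma distributed_Pair_if_indep_vectors:
  fixes X :: "'w \<Rightarrow> 'a::euclidean_space" and Y :: "'w \<Rightarrow> 'b::euclidean_space"
  assumes "prob_space P" and "indep_vectors P X Y"
    and X: "distributed P lborel X (\<lambda>x. ennreal (p x))" and Y: "distributed P lborel Y (\<lambda>y. ennreal (q y))"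
    and p: "\<And>x. 0 \<le> p x"
  shows "distributed P lborel (\<lambda>\<omega>. (X \<omega>, Y \<omega>)) (\<lambda>(x, y). ennreal (p x * q y))"
proof -
  interpret prob_space P by fact
  have [measurable]: "X \<in> borel_measurable P" "Y \<in> borel_measurable P"
    and indep: "indep_set {X -` S \<inter> space P | S. S \<in> sets borel} {Y -` S \<inter> space P | S. S \<in> sets borel}"
    using assms(2) unfolding indep_vectors_def by auto
  interpret X: prob_space "distr P lborel X" by (rule prob_space_distr) simp
  interpret Y: prob_space "distr P lborel Y" by (rule prob_space_distr) simp
  have "distr P lborel X \<Otimes>\<^sub>M distr P lborel Y = distr P (lborel \<Otimes>\<^sub>M lborel) (\<lambda>\<omega>. (X \<omega>, Y \<omega>))"
  proof (rule pair_measure_eqI)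
    fix S T assume "S \<in> sets (distr P lborel X)" "T \<in> sets (distr P lborel Y)"
    then have [measurable]: "S \<in> sets borel" "T \<in> sets borel" by auto
    have "prob ((X -` S \<inter> space P) \<inter> (Y -` T \<inter> space P)) = prob (X -` S \<inter> space P) * prob (Y -` T \<inter> space P)"
      by (rule indep_setD[OF indep]) auto
    moreover have "(\<lambda>\<omega>. (X \<omega>, Y \<omega>)) -` (S \<times> T) \<inter> space P = (X -` S \<inter> space P) \<inter> (Y -` T \<inter> space P)"
      by auto
    ultimately show "emeasure (distr P lborel X) S * emeasure (distr P lborel Y) T
        = emeasure (distr P (lborel \<Otimes>\<^sub>M lborel) (\<lambda>\<omega>. (X \<omega>, Y \<omega>))) (S \<times> T)"
      by (simp add: emeasure_distr emeasure_eq_measure ennreal_mult)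
  qed (auto intro: X.sigma_finite_measure_axioms Y.sigma_finite_measure_axioms)
  from distributed_joint_indep'[OF sigma_finite_lborel sigma_finite_lborel X Y this]
  show ?thesis
    by (simp add: lborel_prod ennreal_mult' p)
qed

lemma integrable_lborel_mult:
  fixes f :: "'a::euclidean_space \<Rightarrow> real" and g :: "'b::euclidean_space \<Rightarrow> real"
  assumes f: "integrable lborel f" and g: "integrable lborel g"
  shows "integrable lborel (\<lambda>(x, y). f x * g y)"
proof -
  note [measurable] = borel_measurable_integrable[OF f] borel_measurable_integrable[OF g]
  have "integrable (lborel \<Otimes>\<^sub>M lborel) (\<lambda>(x, y). f x * g y)"
  proof (rule lborel_pair.Fubini_integrable)
    have "integrable lborel (\<lambda>x. \<bar>f x\<bar> * (\<integral>y. \<bar>g y\<bar> \<partial>lborel))"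
      using f by simp
    then show "integrable lborel (\<lambda>x. \<integral>y. norm (case (x, y) of (x, y) \<Rightarrow> f x * g y) \<partial>lborel)"
      by (simp add: abs_mult)
  qed (use g in auto)
  then show ?thesis by (simp add: lborel_prod)
qed

text \<open>
  \<open>p q ln (p q) = (p ln p) q + p (q ln q)\<close> also where a density vanishes, since \<open>0 * ln 0 = 0\<close>.
\<close>

lemma integrable_mult_ln_product_density:
  fixes p :: "'a::euclidean_space \<Rightarrow> real" and q :: "'b::euclidean_space \<Rightarrow> real"
  assumes "integrable lborel p" "integrable lborel (\<lambda>x. p x * ln (p x))"
    and "integrable lborel q" "integrable lborel (\<lambda>y. q y * ln (q y))"
    and "\<And>x. 0 \<le> p x" "\<And>y. 0 \<le> q y"
  shows "integrable lborel (\<lambda>(x, y). p x * q y * ln (p x * q y))"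
proof -
  have "integrable lborel (\<lambda>z. (case z of (x, y) \<Rightarrow> p x * ln (p x) * q y) + (case z of (x, y) \<Rightarrow> p x * (q y * ln (q y))))"
    by (intro Bochner_Integration.integrable_add integrable_lborel_mult assms)
  moreover have "p x * q y * ln (p x * q y) = p x * ln (p x) * q y + p x * (q y * ln (q y))" for x y
    using assms(5)[of x] assms(6)[of y]
    by (cases "p x = 0"; cases "q y = 0") (simp_all add: ln_mult algebra_simps)
  ultimately show ?thesis by (simp add: case_prod_unfold)
qed

section \<open>Coordinates of the algorithm for given reconstructions\<close>

primrec orbit :: "(nat \<Rightarrow> 'a \<Rightarrow> 'a) \<Rightarrow> nat \<Rightarrow> 'a \<Rightarrow> 'a" where
  "orbit F 0 t = t"
| "orbit F (Suc n) t = F n (orbit F n t)"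

lemma orbit_eqI:
  assumes "\<And>n. n < k \<Longrightarrow> z (Suc n) = F n (z n)"
  shows "z k = orbit F k (z 0)"
  using assms by (induction k) auto

lemma expanding_orbit:
  assumes "\<And>n. n < k \<Longrightarrow> expanding (a n) (F n)" "\<And>n. n < k \<Longrightarrow> 0 \<le> a n"
  shows "expanding (\<Prod>n<k. a n) (orbit F k)"
  using assms
proof (induction k)
  case 0
  then show ?case using expanding_id by (simp add: orbit_def)
next
  case (Suc k)
  have "expanding ((\<Prod>n<k. a n) * a k) (\<lambda>t. F k (orbit F k t))"
    using Suc by (intro expanding_compose prod_nonneg) auto
  then show ?case by (simp add: orbit_def)
qed

text \<open>
  A primal coordinate: concavity pulls points together, but by no more than the curvature
  bound \<open>l\<close> permits. The term \<open>w\<close> stands for the prices, constant once the dual symbols are fixed.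
\<close>

lemma expanding_gradient_step:
  assumes u: "twice_cont_differentiable u" and ge: "\<And>t. l \<le> deriv (deriv u) t"
    and "0 < m" "0 \<le> 1 + m * l"
  shows "expanding (1 + m * l) (\<lambda>t. t + m * (deriv u t - w))"
proof (rule expanding_if_deriv_ge)
  have "(deriv u has_real_derivative deriv (deriv u) t) (at t)" for t
    using u by (simp add: twice_cont_differentiable_def differentiable_on_def DERIV_deriv_iff_real_differentiable)
  note [derivative_intros] = this
  show "((\<lambda>t. t + m * (deriv u t - w)) has_real_derivative 1 + m * deriv (deriv u) t) (at t)" for t
    by (auto intro!: derivative_eq_intros)
  show "continuous_on UNIV (\<lambda>t. 1 + m * deriv (deriv u) t)"
    using u by (auto simp: twice_cont_differentiable_def intro!: continuous_intros)
qed (use ge assms(3,4) in auto)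

lemma expanding_translation: "expanding 1 (\<lambda>t. t + w)"
  by (rule expanding_if_deriv_ge[where \<phi>' = "\<lambda>_. 1"]) (auto intro!: derivative_eq_intros)

section \<open>Transcripts of a quantizer\<close>

text \<open>
  An encoder is only known to hit the alphabet on histories of earlier symbols in their alphabets,
  whence the strong induction on time.
\<close>

lemma symbol_in_alphabet:
  assumes valid: "valid_quantizer Q" and quant: "quantizes Q z s q"
  shows "s k i \<in> alphabet Q i k"
proof (induction k rule: less_induct)
  case (less k)
  let ?M = "(\<Pi>\<^sub>M n\<in>{..k}. (borel :: real measure)) \<Otimes>\<^sub>M (\<Pi>\<^sub>M n\<in>{..<k}. count_space (alphabet Q i n))"
  have "(\<lambda>(z, s). encoder Q i k z s) \<in> ?M \<rightarrow>\<^sub>M count_space (alphabet Q i k)"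
    using valid unfolding valid_quantizer_def by blast
  moreover have "(restrict (\<lambda>n. z n $ i) {..k}, restrict (\<lambda>n. s n i) {..<k}) \<in> space ?M"
    using less by (auto simp: space_pair_measure space_PiM)
  ultimately have "encoder Q i k (restrict (\<lambda>n. z n $ i) {..k}) (restrict (\<lambda>n. s n i) {..<k}) \<in> alphabet Q i k"
    by (auto dest: measurable_space)
  then show ?case
    using quant unfolding quantizes_def by metis
qed

definition transcripts :: "('i, 's) quantizer \<Rightarrow> nat \<Rightarrow> (nat \<Rightarrow> 'i \<Rightarrow> 's) set" where
  "transcripts Q k = (\<Pi>\<^sub>E t\<in>{..<k}. \<Pi>\<^sub>E i\<in>UNIV. alphabet Q i t)"

definition reconstruction :: "('i::finite, 's) quantizer \<Rightarrow> (nat \<Rightarrow> 'i \<Rightarrow> 's) \<Rightarrow> nat \<Rightarrow> real^'i" where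
  "reconstruction Q s n = (\<chi> i. decoder Q i n (restrict (\<lambda>t. s t i) {..n}))"

lemma finite_transcripts:
  fixes Q :: "('i::finite, 's) quantizer"
  shows "valid_quantizer Q \<Longrightarrow> finite (transcripts Q k)"
  unfolding transcripts_def valid_quantizer_def by (intro finite_PiE) auto

lemma ln_card_transcripts:
  fixes Q :: "('i::finite, 's) quantizer"
  assumes "valid_quantizer Q" "\<And>t i. alphabet Q i t \<noteq> {}"
  shows "ln (real (card (transcripts Q k))) = (\<Sum>t<k. \<Sum>i\<in>UNIV. ln (real (card (alphabet Q i t))))"
proof -
  have "card (alphabet Q i t) \<noteq> 0" for i t
    using assms unfolding valid_quantizer_def by auto
  then show ?thesis
    unfolding transcripts_def by (simp add: card_PiE ln_prod prod_zero_iff)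
qed

text \<open>
  What the algorithm sees of a quantizer before time \<open>k\<close> is one of finitely many reconstructed
  sequences.
\<close>

lemma quantizes_transcript:
  assumes "valid_quantizer Q" "quantizes Q z s q"
  obtains \<sigma> where "\<sigma> \<in> transcripts Q k" "\<And>n. n < k \<Longrightarrow> q n = reconstruction Q \<sigma> n"
proof
  show "restrict s {..<k} \<in> transcripts Q k"
    using symbol_in_alphabet[OF assms] by (auto simp: transcripts_def)
  fix n assume "n < k"
  then have "restrict (\<lambda>t. restrict s {..<k} t i) {..n} = restrict (\<lambda>t. s t i) {..n}" for i
    by (auto simp: restrict_def)
  moreover have "q n $ i = decoder Q i n (restrict (\<lambda>t. s t i) {..n})" for i
    using assms(2) unfolding quantizes_def by blast
  ultimately show "q n = reconstruction Q (restrict s {..<k}) n"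
    by (simp add: reconstruction_def vec_eq_iff)
qed

section \<open>Sums over the standard basis\<close>

lemma sum_Basis_cart:
  fixes f :: "real^'k::finite \<Rightarrow> real"
  shows "sum f Basis = (\<Sum>i\<in>UNIV. f (axis i 1))"
proof -
  have axes: "(Basis :: (real^'k) set) = range (\<lambda>i. axis i 1)"
    unfolding Basis_vec_def by simp blast
  have "inj (\<lambda>i::'k. axis i (1::real))"
    by (auto simp: inj_def axis_eq_axis)
  then show ?thesis
    unfolding axes by (subst sum.reindex) (simp_all only: o_def)
qed

lemma sum_Basis_prod:
  fixes f :: "'a::euclidean_space \<times> 'b::euclidean_space \<Rightarrow> real"
  shows "sum f Basis = (\<Sum>u\<in>Basis. f (u, 0)) + (\<Sum>v\<in>Basis. f (0, v))"
proof -
  have "inj_on (\<lambda>u. (u::'a, 0::'b)) Basis" "inj_on (\<lambda>v. (0::'a, v::'b)) Basis"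
    by (auto intro: inj_onI)
  then show ?thesis
    unfolding Basis_prod_def by (subst sum.union_disjoint) (auto simp: sum.reindex)
qed

section \<open>The mean square distance of the primal-dual iterates\<close>

text \<open>
  Here the branches are the pairs of transcripts, and the expansion factor of a coordinate is the
  product of those of its steps, which is \<open>1\<close> for dual coordinates. The comparison point \<open>c\<close>
  is arbitrary: the bound measures how concentrated the iterate can be anywhere.
\<close>

lemma quantized_pd_mean_square_ge:
  fixes A :: "real^'m^'n" and b :: "real^'n"
    and U :: "'m::finite \<Rightarrow> real \<Rightarrow> real"
    and Qx :: "('m, 's) quantizer" and Ql :: "('n::finite, 't) quantizer"
    and x :: "nat \<Rightarrow> 'w \<Rightarrow> real^'m" and lam :: "nat \<Rightarrow> 'w \<Rightarrow> real^'n"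
  assumes U: "\<And>i. twice_cont_differentiable (U i)" and Umin: "\<And>i t. Umin i \<le> deriv (deriv (U i)) t"
    and \<mu>: "\<And>n. 0 < \<mu> n" and factor_pos: "\<And>i n. n < k \<Longrightarrow> 0 < 1 + \<mu> n * Umin i"
    and P: "prob_space P" and indep: "indep_vectors P (x 0) (lam 0)"
    and ent_x: "finite_diff_entropy P (x 0) px0" and ent_lam: "finite_diff_entropy P (lam 0) pl0"
    and Qx: "valid_quantizer Qx" and Ql: "valid_quantizer Ql"
    and pd: "\<And>\<omega>. \<omega> \<in> space P \<Longrightarrow> quantized_pd A b U \<mu> Qx Ql (\<lambda>n. x n \<omega>) (\<lambda>n. lam n \<omega>)"
  defines "d \<equiv> real CARD('m) + real CARD('n)"
  shows "ennreal (d / (2 * pi * exp 1) * exp (2 / d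
      * ((\<Sum>i\<in>UNIV. \<Sum>n<k. ln (1 + \<mu> n * Umin i)) + diff_entropy P (\<lambda>\<omega>. (x 0 \<omega>, lam 0 \<omega>))
         - (\<Sum>t<k. (\<Sum>i\<in>UNIV. ln (real (card (alphabet Qx i t))))
                + (\<Sum>j\<in>UNIV. ln (real (card (alphabet Ql j t))))))))
    \<le> (\<integral>\<^sup>+\<omega>. ennreal ((norm ((x k \<omega>, lam k \<omega>) - c))\<^sup>2) \<partial>P)"
proof -
  interpret prob_space P by fact
  interpret information_space P "exp 1" by unfold_locales simp
  have px0: "distributed P lborel (x 0) (\<lambda>z. ennreal (px0 z))" "\<And>z. 0 \<le> px0 z"
      "integrable lborel (\<lambda>z. px0 z * ln (px0 z))"
    and pl0: "distributed P lborel (lam 0) (\<lambda>z. ennreal (pl0 z))" "\<And>z. 0 \<le> pl0 z"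
      "integrable lborel (\<lambda>z. pl0 z * ln (pl0 z))"
    using ent_x ent_lam unfolding finite_diff_entropy_def finite_entropy_def by (auto simp: log_def)
  define p where "p = (\<lambda>(u, v). px0 u * pl0 v)"
  have p_nonneg: "0 \<le> p z" for z
    using px0(2) pl0(2) by (simp add: p_def case_prod_unfold)
  have p_dist: "distributed P lborel (\<lambda>\<omega>. (x 0 \<omega>, lam 0 \<omega>)) (\<lambda>z. ennreal (p z))"
    using distributed_Pair_if_indep_vectors[OF P indep px0(1) pl0(1) px0(2)]
    by (simp add: p_def case_prod_unfold)
  have "integrable lborel px0" "integrable lborel pl0"
    using distributed_integrable[OF px0(1), of "\<lambda>_. 1::real"] distributed_integrable[OF pl0(1), of "\<lambda>_. 1::real"] px0(2) pl0(2)
    by auto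
  then have p_ent: "integrable lborel (\<lambda>z. p z * ln (p z))"
    using integrable_mult_ln_product_density[of px0 pl0] px0 pl0 by (simp add: p_def case_prod_unfold)
  have entropy_eq: "diff_entropy P (\<lambda>\<omega>. (x 0 \<omega>, lam 0 \<omega>)) = - (\<integral>z. p z * ln (p z) \<partial>lborel)"
    by (rule diff_entropy_density[OF P p_dist p_nonneg])
  \<comment> \<open>Basis vectors of the product space have the form \<open>(axis i 1, 0)\<close> (primal) or \<open>(0, axis j 1)\<close> (dual).\<close>
  define a :: "(real^'m) \<times> (real^'n) \<Rightarrow> real" where
    "a e = (if snd e = 0 then \<Prod>n<k. 1 + \<mu> n * Umin (axis_index (fst e)) else \<Prod>n<k. 1)" for e
  define \<phi> :: "(nat \<Rightarrow> 'm \<Rightarrow> 's) \<times> (nat \<Rightarrow> 'n \<Rightarrow> 't) \<Rightarrow> (real^'m) \<times> (real^'n) \<Rightarrow> real \<Rightarrow> real" where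
    "\<phi> \<sigma> e = (if snd e = 0
       then orbit (\<lambda>n t. t + \<mu> n * (deriv (U (axis_index (fst e))) t
              - column (axis_index (fst e)) A \<bullet> reconstruction Ql (snd \<sigma>) n)) k
       else orbit (\<lambda>n t. t + \<mu> n * (row (axis_index (snd e)) A \<bullet> reconstruction Qx (fst \<sigma>) n
              - b $ axis_index (snd e))) k)" for \<sigma> e
  have a_pos: "0 < a e" for e
    unfolding a_def using factor_pos by (auto intro!: prod_pos)
  have \<phi>_expanding: "expanding (a e) (\<phi> \<sigma> e)" for \<sigma> e
  proof (cases "snd e = 0")
    case True
    then show ?thesis
      unfolding a_def \<phi>_def if_P[OF True]
      by (intro expanding_orbit expanding_gradient_step U Umin \<mu> less_imp_le[OF factor_pos])
  next
    case False
    then show ?thesis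
      unfolding a_def \<phi>_def if_not_P[OF False]
      by (intro expanding_orbit expanding_translation; simp)
  qed
  have branch: "\<exists>\<sigma>\<in>transcripts Qx k \<times> transcripts Ql k.
      \<forall>e\<in>Basis. (x k \<omega>, lam k \<omega>) \<bullet> e = \<phi> \<sigma> e ((x 0 \<omega>, lam 0 \<omega>) \<bullet> e)" if \<omega>: "\<omega> \<in> space P" for \<omega>
  proof -
    obtain sx qx sl ql where
      qx: "quantizes Qx (\<lambda>n. x n \<omega>) sx qx" and ql: "quantizes Ql (\<lambda>n. lam n \<omega>) sl ql"
      and x_step: "\<And>n i. x (Suc n) \<omega> $ i = x n \<omega> $ i + \<mu> n * (deriv (U i) (x n \<omega> $ i) - column i A \<bullet> ql n)"
      and lam_step: "\<And>n j. lam (Suc n) \<omega> $ j = lam n \<omega> $ j + \<mu> n * (row j A \<bullet> qx n - b $ j)"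
      using pd[OF \<omega>] unfolding quantized_pd_def by blast
    obtain \<sigma>x where \<sigma>x: "\<sigma>x \<in> transcripts Qx k" "\<And>n. n < k \<Longrightarrow> qx n = reconstruction Qx \<sigma>x n"
      using quantizes_transcript[OF Qx qx] by metis
    obtain \<sigma>l where \<sigma>l: "\<sigma>l \<in> transcripts Ql k" "\<And>n. n < k \<Longrightarrow> ql n = reconstruction Ql \<sigma>l n"
      using quantizes_transcript[OF Ql ql] by metis
    have x_k: "x k \<omega> $ i = orbit (\<lambda>n t. t + \<mu> n * (deriv (U i) t - column i A \<bullet> reconstruction Ql \<sigma>l n)) k (x 0 \<omega> $ i)" for i
      by (rule orbit_eqI[of k "\<lambda>n. x n \<omega> $ i"]) (simp add: x_step \<sigma>l)
    have lam_k: "lam k \<omega> $ j = orbit (\<lambda>n t. t + \<mu> n * (row j A \<bullet> reconstruction Qx \<sigma>x n - b $ j)) k (lam 0 \<omega> $ j)" for j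
      by (rule orbit_eqI[of k "\<lambda>n. lam n \<omega> $ j"]) (simp add: lam_step \<sigma>x)
    have "(x k \<omega>, lam k \<omega>) \<bullet> e = \<phi> (\<sigma>x, \<sigma>l) e ((x 0 \<omega>, lam 0 \<omega>) \<bullet> e)" if e: "e \<in> Basis" for e
    proof -
      consider i where "e = (axis i 1, 0)" | j where "e = (0, axis j 1)"
        using e by (auto simp: Basis_prod_def Basis_vec_def)
      then show ?thesis
        by cases (simp_all add: \<phi>_def x_k lam_k inner_axis axis_index_axis)
    qed
    with \<sigma>x(1) \<sigma>l(1) show ?thesis by auto
  qed
  obtain \<omega>0 where "\<omega>0 \<in> space P"
    using not_empty by blast
  then have nonempty: "alphabet Qx i t \<noteq> {}" "alphabet Ql j t \<noteq> {}" for i j t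
    using pd symbol_in_alphabet[OF Qx] symbol_in_alphabet[OF Ql] unfolding quantized_pd_def by blast+
  have card_ne_0: "card (alphabet Qx i t) \<noteq> 0" "card (alphabet Ql j t) \<noteq> 0" for i j t
    using Qx Ql nonempty unfolding valid_quantizer_def by auto
  have alphabets: "ln (real (card (transcripts Qx k \<times> transcripts Ql k)))
      = (\<Sum>t<k. (\<Sum>i\<in>UNIV. ln (real (card (alphabet Qx i t)))) + (\<Sum>j\<in>UNIV. ln (real (card (alphabet Ql j t)))))"
  proof -
    have "card (transcripts Qx k) \<noteq> 0" "card (transcripts Ql k) \<noteq> 0"
      unfolding transcripts_def using card_ne_0 by (simp_all add: card_PiE)
    then have "ln (real (card (transcripts Qx k \<times> transcripts Ql k)))
        = ln (real (card (transcripts Qx k))) + ln (real (card (transcripts Ql k)))"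
      by (simp add: card_cartesian_product ln_mult)
    then show ?thesis
      by (simp add: ln_card_transcripts[OF Qx nonempty(1)] ln_card_transcripts[OF Ql nonempty(2)] sum.distrib)
  qed
  have factors: "(\<Sum>e\<in>Basis. ln (a e)) = (\<Sum>i\<in>UNIV. \<Sum>n<k. ln (1 + \<mu> n * Umin i))"
  proof -
    have "ln (\<Prod>n<k. 1 + \<mu> n * Umin i) = (\<Sum>n<k. ln (1 + \<mu> n * Umin i))" for i
      by (rule ln_prod) (use factor_pos in \<open>auto simp: less_imp_neq[symmetric]\<close>)
    then show ?thesis
      by (simp add: sum_Basis_prod sum_Basis_cart a_def axis_index_axis axis_eq_0_iff)
  qed
  have "finite (transcripts Qx k \<times> transcripts Ql k)"
    by (intro finite_cartesian_product finite_transcripts Qx Ql)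
  from mean_square_ge_of_expanding_branches[OF P p_dist p_nonneg p_ent this \<phi>_expanding a_pos branch, of c]
  show ?thesis
    by (simp add: d_def entropy_eq factors alphabets add.commute)
qed

section \<open>Passage to logarithms\<close>

text \<open>
  The sharp constant \<open>d / (2 pi e)\<close> is weakened to \<open>exp (1 - 1/d) / (2 pi e)\<close> by
  \<open>ln d \<ge> 1 - 1/d\<close>.
\<close>

lemma exp_one_minus_inverse_le:
  fixes d :: real
  assumes "0 < d"
  shows "exp (1 - 1 / d) \<le> d"
proof -
  have "ln (1 / d) \<le> 1 / d - 1"
    using assms by (intro ln_le_minus_one) simp
  then have "1 - 1 / d \<le> ln d"
    using assms by (simp add: ln_div)
  then show ?thesis
    using assms by (simp add: ln_ge_iff)
qed

lemma ereal_ln_le_ext_ln: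
  assumes "0 < r" "ennreal r \<le> V"
  shows "ereal (ln r) \<le> ext_ln V"
proof (cases V)
  case (real v)
  with assms have "r \<le> v" "0 < v" by auto
  with assms real show ?thesis by (simp add: ext_ln_def)
qed (simp add: ext_ln_def)


lemma sum_ereal_eq_MInfty:
  fixes f :: "'a \<Rightarrow> ereal"
  assumes "finite I" "\<And>i. i \<in> I \<Longrightarrow> f i \<noteq> \<infinity>" "i \<in> I" "f i = - \<infinity>"
  shows "sum f I = - \<infinity>"
proof -
  have "sum f I = f i + sum f (I - {i})"
    using assms by (intro sum.remove)
  moreover have "sum f (I - {i}) \<noteq> \<infinity>"
    using assms by (auto simp: sum_Pinfty)
  ultimately show ?thesis
    using assms by (cases "sum f (I - {i})") auto
qed

lemma ext_ln_ennreal: "0 < r \<Longrightarrow> ext_ln (ennreal r) = ereal (ln r)"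
  by (simp add: ext_ln_def)

theorem corollary1:
  fixes A :: "real^'m^'n" and b :: "real^'n"
    and U :: "'m::finite \<Rightarrow> real \<Rightarrow> real" and Umin Umax :: "'m \<Rightarrow> real"
    and \<mu> :: "nat \<Rightarrow> real" and \<mu>star :: real
    and xstar :: "real^'m" and lamstar :: "real^'n"
    and Qx :: "('m, 's) quantizer" and Ql :: "('n::finite, 't) quantizer"
    and P :: "'w measure"
    and x :: "nat \<Rightarrow> 'w \<Rightarrow> real^'m" and lam :: "nat \<Rightarrow> 'w \<Rightarrow> real^'n"
    and px0 :: "real^'m \<Rightarrow> real" and pl0 :: "real^'n \<Rightarrow> real"
    and k :: nat
  assumes "CARD('n) < CARD('m)"
    and "primal_optimal A b U xstar" and "dual_optimal A b U lamstar"
    and "\<And>i. concave_on UNIV (U i)" and "\<And>i. twice_cont_differentiable (U i)"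
    and "\<And>i t. Umin i \<le> deriv (deriv (U i)) t"
    and "\<And>i t. deriv (deriv (U i)) t \<le> Umax i" and "\<And>i. Umax i < 0"
    and "\<And>n. 0 < \<mu> n" and "\<And>n. \<mu> n \<le> (MIN i. 1 / \<bar>Umin i\<bar>)"
    and "\<mu> \<longlonglongrightarrow> \<mu>star" and "0 < \<mu>star"
    and "prob_space P"
    and "indep_vectors P (x 0) (lam 0)"
    and "finite_diff_entropy P (x 0) px0" and "finite_diff_entropy P (lam 0) pl0"
    and "valid_quantizer Qx" and "valid_quantizer Ql"
    and "\<And>\<omega>. \<omega> \<in> space P \<Longrightarrow> quantized_pd A b U \<mu> Qx Ql (\<lambda>n. x n \<omega>) (\<lambda>n. lam n \<omega>)"
  shows "ext_ln (\<integral>\<^sup>+\<omega>. ennreal ((norm ((x k \<omega>, lam k \<omega>) - (xstar, lamstar)))\<^sup>2) \<partial>P)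
    \<ge> ereal (ln (exp (1 - 1 / (real CARD('m) + real CARD('n))) / (2 * pi * exp 1)))
      + ereal (2 / (real CARD('n) + real CARD('m)))
        * ((\<Sum>i\<in>UNIV. \<Sum>n<k. ext_ln (ennreal (1 + \<mu> n * Umin i)))
           + ereal (diff_entropy P (\<lambda>\<omega>. (x 0 \<omega>, lam 0 \<omega>)))
           - ereal (\<Sum>t<k. (\<Sum>i\<in>UNIV. ln (real (card (alphabet Qx i t))))
                        + (\<Sum>j\<in>UNIV. ln (real (card (alphabet Ql j t))))))"
proof -
  define d where "d = real CARD('m) + real CARD('n)"
  have d: "0 < d"
    by (simp add: d_def add_pos_pos)
  define c0 where "c0 = exp (1 - 1 / d) / (2 * pi * exp 1)"
  have c0: "0 < c0" "c0 \<le> d / (2 * pi * exp 1)"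
    using exp_one_minus_inverse_le[OF d] by (auto simp: c0_def divide_right_mono)
  define h where "h = diff_entropy P (\<lambda>\<omega>. (x 0 \<omega>, lam 0 \<omega>))"
  define bits where "bits = (\<Sum>t<k. (\<Sum>i\<in>UNIV. ln (real (card (alphabet Qx i t))))
                        + (\<Sum>j\<in>UNIV. ln (real (card (alphabet Ql j t)))))"
  let ?V = "\<integral>\<^sup>+\<omega>. ennreal ((norm ((x k \<omega>, lam k \<omega>) - (xstar, lamstar)))\<^sup>2) \<partial>P"
  let ?F = "\<Sum>i\<in>UNIV. \<Sum>n<k. ext_ln (ennreal (1 + \<mu> n * Umin i))"
  have "ereal (ln c0) + ereal (2 / d) * (?F + ereal h - ereal bits) \<le> ext_ln ?V"
  proof (cases "\<forall>i. \<forall>n<k. 0 < 1 + \<mu> n * Umin i")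
    case True
    define F where "F = (\<Sum>i\<in>UNIV. \<Sum>n<k. ln (1 + \<mu> n * Umin i))"
    have F: "?F = ereal F"
      using True by (simp add: ext_ln_ennreal F_def)
    have "c0 * exp (2 / d * (F + h - bits)) \<le> d / (2 * pi * exp 1) * exp (2 / d * (F + h - bits))"
      using c0 by (intro mult_right_mono) auto
    then have "ennreal (c0 * exp (2 / d * (F + h - bits)))
        \<le> ennreal (d / (2 * pi * exp 1) * exp (2 / d * (F + h - bits)))"
      by (rule ennreal_leI)
    also have "\<dots> \<le> ?V"
      unfolding d_def F_def h_def bits_def
      by (rule quantized_pd_mean_square_ge[OF assms(5,6,9) _ assms(13-19)]) (use True in auto)
    finally have "ereal (ln (c0 * exp (2 / d * (F + h - bits)))) \<le> ext_ln ?V"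
      using c0 by (intro ereal_ln_le_ext_ln) auto
    then show ?thesis
      using c0 by (simp add: F ln_mult)
  next
    case False
    then obtain i n where "n < k" "1 + \<mu> n * Umin i \<le> 0"
      by (auto simp: not_less)
    have finite_log: "ext_ln (ennreal r) \<noteq> \<infinity>" for r
      by (simp add: ext_ln_def)
    have "(\<Sum>n<k. ext_ln (ennreal (1 + \<mu> n * Umin i))) = - \<infinity>"
      by (rule sum_ereal_eq_MInfty[of _ _ n])
         (use \<open>n < k\<close> \<open>1 + \<mu> n * Umin i \<le> 0\<close> finite_log in \<open>auto simp: ext_ln_def ennreal_neg\<close>)
    then have "?F = - \<infinity>"
      by (intro sum_ereal_eq_MInfty[of _ _ i]) (auto simp: sum_Pinfty finite_log)
    then show ?thesis
      using d by simp
  qed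
  then show ?thesis
    by (simp add: d_def c0_def h_def bits_def add.commute)
qed

end
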